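(* Let $f=h\overline{g}$ be a non-vanishing, sense-preserving and locally univalent log-harmonic mapping in the unit disk $\mathbb{D}$ with dilatation $\omega=\dfrac{g'h}{h'g}$. Suppose that $\log g$ is an analytic Bloch function in $\mathbb{D}$. Then for each $\epsilon\in\overline{\mathbb{D}}$, either $\|P_f\|=\|P_{hg^{\epsilon}}\|=\infty$, or both $\|P_f\|$ and $\|P_{hg^{\epsilon}}\|$ are finite. If $\|P_f\|$ is finite, then $$\bigl|\,\|P_f\|-\|P_{hg^{\epsilon}}\|\,\bigr|\le 1+|1-\epsilon|\,\beta_{\log g}\le 1+2\,\beta_{\log g}$$ for each $\epsilon\in\overline{\mathbb{D}}$. In particular, $\bigl|\,\|P_f\|-\|P_h\|\,\bigr|\le 1+\beta_{\log g}$.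
   Context: $\mathbb{D}=\{z\in\mathbb{C}:|z|<1\}$ and $\overline{\mathbb{D}}$ is its closure. A non-vanishing log-harmonic mapping in $\mathbb{D}$ is a function $f=h\overline{g}$ with $h,g$ non-vanishing analytic functions in $\mathbb{D}$, solving $\overline{f_{\bar z}}/\overline{f}=\omega\, f_z/f$ for some analytic $\omega:\mathbb{D}\to\mathbb{D}$ (the second complex dilatation). It is sense-preserving and locally univalent when its Jacobian $J_f=|f_z|^2-|f_{\bar z}|^2=|h'g|^2(1-|\omega|^2)$ is positive in $\mathbb{D}$; then $h'g\ne 0$ in $\mathbb{D}$ and $\omega=g'h/(h'g)$. Pre-Schwarzian derivative of such an $f$: $P_f=\dfrac{\partial}{\partial z}\log J_f=\dfrac{h''}{h'}+\dfrac{g'}{g}-\dfrac{\overline{\omega}\,\omega'}{1-|\omega|^2}$. For a locally univalent analytic function $F$ in $\mathbb{D}$: $P_F=F''/F'$. In both cases $\|P_F\|=\sup_{z\in\mathbb{D}}(1-|z|^2)|P_F(z)|\in[0,\infty]$. $\log g$ denotes the analytic branch on $\mathbb{D}$ of the logarithm of the non-vanishing function $g$ whose value at $0$ is the principal one, and $g^{\epsilon}=\exp(\epsilon\log g)$. The function $hg^{\epsilon}$ is analytic and locally univalent, since $(hg^\epsilon)'=h'g^\epsilon(1+\epsilon\omega)$. An analytic function $F$ in $\mathbb{D}$ is a Bloch function if $\beta_F:=\sup_{z\in\mathbb{D}}(1-|z|^2)|F'(z)|<\infty$; thus $\beta_{\log g}=\sup_{z\in\mathbb{D}}(1-|z|^2)|g'(z)/g(z)|$.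 *)

theory Defs
  imports "HOL-Complex_Analysis.Complex_Analysis"
begin

abbreviation unit_disc :: "complex set" where
  "unit_disc \<equiv> ball 0 1"

text \<open>
  The Wirtinger derivatives \<open>f\<^sub>z = (f\<^sub>x - \<i> f\<^sub>y) / 2\<close> and \<open>f\<^bsub>z-bar\<^esub> = (f\<^sub>x + \<i> f\<^sub>y) / 2\<close>;
  the real partial derivatives are the values of the Frechet derivative at \<open>1\<close> and \<open>\<i>\<close>.
\<close>

definition wirtinger_z :: "(complex \<Rightarrow> complex) \<Rightarrow> complex \<Rightarrow> complex" where
  "wirtinger_z f z =
     (frechet_derivative f (at z) 1 - \<i> * frechet_derivative f (at z) \<i>) / 2"

definition wirtinger_zbar :: "(complex \<Rightarrow> complex) \<Rightarrow> complex \<Rightarrow> complex" where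
  "wirtinger_zbar f z =
     (frechet_derivative f (at z) 1 + \<i> * frechet_derivative f (at z) \<i>) / 2"

definition jacobian :: "(complex \<Rightarrow> complex) \<Rightarrow> complex \<Rightarrow> real" where
  "jacobian f z = (norm (wirtinger_z f z))\<^sup>2 - (norm (wirtinger_zbar f z))\<^sup>2"

definition nonvanishing_log_harmonic ::
  "(complex \<Rightarrow> complex) \<Rightarrow> (complex \<Rightarrow> complex) \<Rightarrow> (complex \<Rightarrow> complex) \<Rightarrow> (complex \<Rightarrow> complex) \<Rightarrow> bool"
where
  "nonvanishing_log_harmonic f h g \<omega> \<longleftrightarrow>
     h holomorphic_on unit_disc \<and> g holomorphic_on unit_disc \<and>
     (\<forall>z\<in>unit_disc. h z \<noteq> 0 \<and> g z \<noteq> 0) \<and>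
     (\<forall>z\<in>unit_disc. f z = h z * cnj (g z)) \<and>
     \<omega> holomorphic_on unit_disc \<and> \<omega> ` unit_disc \<subseteq> unit_disc \<and>
     (\<forall>z\<in>unit_disc. cnj (wirtinger_zbar f z) / cnj (f z) = \<omega> z * (wirtinger_z f z / f z))"

text \<open>
  For log-harmonic mappings, being sense-preserving and locally univalent means, by
  convention, having a positive Jacobian.
\<close>

definition sense_preserving_locally_univalent :: "(complex \<Rightarrow> complex) \<Rightarrow> bool" where
  "sense_preserving_locally_univalent f \<longleftrightarrow> (\<forall>z\<in>unit_disc. jacobian f z > 0)"

definition pre_schwarzian_log_harmonic :: "(complex \<Rightarrow> complex) \<Rightarrow> complex \<Rightarrow> complex" where
  "pre_schwarzian_log_harmonic f =
     wirtinger_z (\<lambda>z. complex_of_real (ln (jacobian f z)))"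

definition pre_schwarzian :: "(complex \<Rightarrow> complex) \<Rightarrow> complex \<Rightarrow> complex" where
  "pre_schwarzian F z = deriv (deriv F) z / deriv F z"

text \<open>
  The weighted supremum takes values in \<open>[0, \<infinity>]\<close>. It is an extended real, rather than an
  extended nonnegative real, so that differences can be formed without truncation.
\<close>

definition hyperbolic_norm :: "(complex \<Rightarrow> complex) \<Rightarrow> ereal" where
  "hyperbolic_norm P = (SUP z\<in>unit_disc. ereal ((1 - (norm z)\<^sup>2) * norm (P z)))"

definition bloch_seminorm :: "(complex \<Rightarrow> complex) \<Rightarrow> ereal" where
  "bloch_seminorm F = hyperbolic_norm (deriv F)"

definition bloch_function :: "(complex \<Rightarrow> complex) \<Rightarrow> bool" where
  "bloch_function F \<longleftrightarrow> F holomorphic_on unit_disc \<and> bloch_seminorm F < \<infinity>"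

definition is_log_branch :: "(complex \<Rightarrow> complex) \<Rightarrow> (complex \<Rightarrow> complex) \<Rightarrow> bool" where
  "is_log_branch g L \<longleftrightarrow>
     L holomorphic_on unit_disc \<and> (\<forall>z\<in>unit_disc. exp (L z) = g z) \<and> L 0 = Ln (g 0)"

text \<open>
  The branch is determined on the disc only, hence the choice operator; existence
  and uniqueness on the disc are shown below.
\<close>

definition log_branch :: "(complex \<Rightarrow> complex) \<Rightarrow> complex \<Rightarrow> complex" where
  "log_branch g = (SOME L. is_log_branch g L)"

definition branch_power :: "(complex \<Rightarrow> complex) \<Rightarrow> complex \<Rightarrow> complex \<Rightarrow> complex" where
  "branch_power g \<epsilon> z = exp (\<epsilon> * log_branch g z)"

lemma is_log_branch_log_branch:
  assumes "g holomorphic_on unit_disc" "\<And>z. z \<in> unit_disc \<Longrightarrow> g z \<noteq> 0"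
  shows "is_log_branch g (log_branch g)"
proof -
  obtain l where l: "l holomorphic_on unit_disc" "\<And>z. z \<in> unit_disc \<Longrightarrow> g z = exp (l z)"
    using contractible_imp_holomorphic_log[of g unit_disc] assms convex_imp_contractible[of unit_disc]
    by auto
  define L where "L = (\<lambda>z. l z - l 0 + Ln (g 0))"
  have 0: "g 0 = exp (l 0)" "g 0 \<noteq> 0" using l(2)[of 0] by auto
  have "exp (L z) = g z" if "z \<in> unit_disc" for z
    using l(2)[OF that] 0 by (simp add: L_def exp_add exp_diff)
  moreover have "L holomorphic_on unit_disc"
    unfolding L_def by (intro holomorphic_intros l)
  ultimately have "is_log_branch g L"
    by (simp add: is_log_branch_def L_def)
  thus ?thesis
    unfolding log_branch_def by (rule someI[where P = "is_log_branch g"])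
qed

lemma is_log_branch_unique:
  assumes "is_log_branch g L" "is_log_branch g M" "z \<in> unit_disc"
  shows "L z = M z"
proof -
  have hol: "L holomorphic_on unit_disc" "M holomorphic_on unit_disc"
    and ex: "\<And>z. z \<in> unit_disc \<Longrightarrow> exp (L z) = g z" "\<And>z. z \<in> unit_disc \<Longrightarrow> exp (M z) = g z"
    and at0: "L 0 = M 0"
    using assms by (auto simp: is_log_branch_def)
  have "((\<lambda>w. L w - M w) has_field_derivative 0) (at w)" if w: "w \<in> unit_disc" for w
  proof -
    have d: "(L has_field_derivative deriv L w) (at w)" "(M has_field_derivative deriv M w) (at w)"
      using hol w by (auto intro: holomorphic_derivI)
    have "((\<lambda>w. exp (L w)) has_field_derivative exp (L w) * deriv L w) (at w)"
      using d by (auto intro!: derivative_eq_intros)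
    moreover have "((\<lambda>w. exp (M w)) has_field_derivative exp (M w) * deriv M w) (at w)"
      using d by (auto intro!: derivative_eq_intros)
    hence "((\<lambda>w. exp (L w)) has_field_derivative exp (M w) * deriv M w) (at w)"
      by (rule has_field_derivative_transform_within_open[where S = unit_disc])
         (use w ex in auto)
    ultimately have "exp (L w) * deriv L w = exp (M w) * deriv M w"
      by (rule DERIV_unique)
    hence "deriv L w = deriv M w" using ex[OF w] by (metis exp_not_eq_zero mult_left_cancel)
    thus ?thesis using d by (auto intro!: derivative_eq_intros)
  qed
  hence "\<exists>c. \<forall>w\<in>unit_disc. L w - M w = c"
    by (intro has_field_derivative_zero_constant) (auto intro: DERIV_subset)
  then obtain c where c: "\<And>w. w \<in> unit_disc \<Longrightarrow> L w - M w = c" by blast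
  have "c = 0" using c[of 0] at0 by simp
  thus ?thesis using c[OF assms(3)] by simp
qed

end

theory Submission
  imports Defs
begin

text \<open>
  Both pre-Schwarzian derivatives are explicit in terms of \<open>h\<close>, \<open>g\<close> and \<open>\<omega>\<close>.  The Jacobian is
  \<open>\<bar>F\<bar>\<^sup>2 - \<bar>G\<bar>\<^sup>2\<close> with \<open>F = h' g\<close> and \<open>G = h g' = \<omega> F\<close>, while \<open>(h g\<^sup>\<epsilon>)' = h' g\<^sup>\<epsilon> (1 + \<epsilon> \<omega>)\<close>.
  On subtracting, the term \<open>h'' / h'\<close> disappears and, because
  \<open>cnj \<omega> (1 + \<epsilon> \<omega>) + \<epsilon> (1 - \<bar>\<omega>\<bar>\<^sup>2) = cnj \<omega> + \<epsilon>\<close>, what is left is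
  \<open>(1 - \<epsilon>) g' / g - ((cnj \<omega> + \<epsilon>) / (1 + \<epsilon> \<omega>)) (\<omega>' / (1 - \<bar>\<omega>\<bar>\<^sup>2))\<close>.
  The factor \<open>(cnj \<omega> + \<epsilon>) / (1 + \<epsilon> \<omega>)\<close> has modulus at most \<open>1\<close> (\<open>norm_cnj_add_le\<close>), and the
  Schwarz--Pick inequality (\<open>Schwarz_Pick_deriv\<close>) bounds the weighted modulus of the last
  quotient by \<open>1\<close>.  Since \<open>g' / g\<close> is the derivative of \<open>log g\<close>, the two pre-Schwarzian derivatives
  differ, in weighted modulus and at every point, by at most \<open>1 + \<bar>1 - \<epsilon>\<bar> \<beta>\<close>, where \<open>\<beta>\<close> is the
  Bloch seminorm of \<open>log g\<close>.  A finite pointwise bound passes to the suprema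
  (\<open>hyperbolic_norm_diff_le\<close>), which gives the dichotomy and the inequalities together; the
  statement about \<open>h\<close> is the case \<open>\<epsilon> = 0\<close>.
\<close>

section \<open>Inequalities in the unit disc\<close>

text \<open>
  Moving both \<open>a\<close> and \<open>w a\<close> to the origin by disc automorphisms reduces the claim to the bound
  \<open>\<bar>\<phi>'(0)\<bar> \<le> 1\<close> of the Schwarz lemma.
\<close>

lemma Schwarz_Pick_deriv:
  assumes hol: "w holomorphic_on unit_disc" and self: "w ` unit_disc \<subseteq> unit_disc"
    and a: "a \<in> unit_disc"
  shows "(1 - (norm a)\<^sup>2) * norm (deriv w a) \<le> 1 - (norm (w a))\<^sup>2"
proof -
  define b where "b = w a"
  have na: "norm a < 1" and nb: "norm b < 1" using a image_subset_iff[THEN iffD1, OF self] by (auto simp: b_def)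
  define M where "M = (\<lambda>c z. Moebius_function 0 c z)"
  have M: "M c z = (z - c) / (1 - cnj c * z)" for c z
    by (simp add: M_def Moebius_function_simple)
  have sq: "cnj c * c = of_real ((norm c)\<^sup>2)" for c
    by (metis complex_norm_square mult.commute of_real_power)
  have pos: "1 - (norm a)\<^sup>2 > 0" "1 - (norm b)\<^sup>2 > 0"
    using na nb by (auto simp: power_less_one_iff abs_square_less_1)
  have nz: "1 - cnj b * b \<noteq> 0"
    using pos(2) unfolding sq by (metis of_real_1 of_real_diff of_real_eq_0_iff less_irrefl)
  define \<phi> where "\<phi> = M b \<circ> (w \<circ> M (- a))"
  have Ma: "M (- a) holomorphic_on unit_disc" and Mb: "M b holomorphic_on unit_disc"
    using Moebius_function_holomorphic na nb by (auto simp: M_def)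
  have Masub: "M (- a) ` unit_disc \<subseteq> unit_disc" and Mbsub: "M b ` unit_disc \<subseteq> unit_disc"
    using Moebius_function_norm_lt_1 na nb by (auto simp: M_def)
  have wsub: "(w \<circ> M (- a)) ` unit_disc \<subseteq> unit_disc" using Masub self by fastforce
  have hol\<phi>: "\<phi> holomorphic_on unit_disc"
    unfolding \<phi>_def
    by (intro holomorphic_on_compose_gen[OF _ Mb wsub] holomorphic_on_compose_gen[OF Ma hol Masub])
  have \<phi>sub: "norm (\<phi> z) < 1" if "norm z < 1" for z
    using wsub Mbsub that by (force simp: \<phi>_def)
  have \<phi>0: "\<phi> 0 = 0" by (simp add: \<phi>_def M b_def)
  have d1: "(M (- a) has_field_derivative (1 - cnj a * a)) (at 0)"
    unfolding M by (auto intro!: derivative_eq_intros simp: algebra_simps)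
  have d2: "(M b has_field_derivative 1 / (1 - cnj b * b)) (at b)"
  proof -
    have "((\<lambda>z. z - b) has_field_derivative 1) (at b)"
      and "((\<lambda>z. 1 - cnj b * z) has_field_derivative - cnj b) (at b)"
      by (auto intro!: derivative_eq_intros)
    from DERIV_divide[OF this nz] show ?thesis using nz by (simp add: M[abs_def])
  qed
  have d3: "(w has_field_derivative deriv w a) (at a)"
    using hol a by (auto intro: holomorphic_derivI)
  have M0: "M (- a) 0 = a" by (simp add: M)
  have "(\<phi> has_field_derivative 1 / (1 - cnj b * b) * (deriv w a * (1 - cnj a * a))) (at 0)"
    unfolding \<phi>_def
  proof (rule DERIV_chain)
    show "(w \<circ> M (- a) has_field_derivative deriv w a * (1 - cnj a * a)) (at 0)"
      by (rule DERIV_chain[OF _ d1]) (use d3 M0 in simp)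
    show "(M b has_field_derivative 1 / (1 - cnj b * b)) (at ((w \<circ> M (- a)) 0))"
      using d2 M0 b_def by simp
  qed
  hence "deriv \<phi> 0 = 1 / (1 - cnj b * b) * (deriv w a * (1 - cnj a * a))"
    by (rule DERIV_imp_deriv)
  moreover have "norm (deriv \<phi> 0) \<le> 1"
    by (rule Schwarz_Lemma(2)[OF hol\<phi> \<phi>0 \<phi>sub, of 0]) auto
  ultimately have le: "norm (deriv w a) * norm (1 - cnj a * a) / norm (1 - cnj b * b) \<le> 1"
    by (simp only: norm_mult norm_divide norm_one) simp
  have norm1: "norm (1 - cnj c * c) = 1 - (norm c)\<^sup>2" if "1 - (norm c)\<^sup>2 > 0" for c :: complex
    unfolding sq by (metis abs_of_pos norm_of_real of_real_1 of_real_diff that)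
  show ?thesis
    using le pos unfolding norm1[OF pos(1)] norm1[OF pos(2)]
    by (simp add: b_def pos_divide_le_eq mult.commute)
qed

text \<open>
  The difference of the two squared moduli is \<open>(1 - \<bar>w\<bar>\<^sup>2) (1 - \<bar>e\<bar>\<^sup>2)\<close>.
\<close>

lemma norm_cnj_add_le:
  fixes w e :: complex
  assumes "norm w \<le> 1" "norm e \<le> 1"
  shows "norm (cnj w + e) \<le> norm (1 + e * w)"
proof -
  have "(norm (1 + e * w))\<^sup>2 - (norm (cnj w + e))\<^sup>2 = (1 - (norm w)\<^sup>2) * (1 - (norm e)\<^sup>2)"
    unfolding cmod_power2 by (simp add: power2_eq_square algebra_simps)
  also have "\<dots> \<ge> 0" using assms by (simp add: power_le_one)
  finally have "(norm (cnj w + e))\<^sup>2 \<le> (norm (1 + e * w))\<^sup>2" by linarith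
  thus ?thesis by (rule power2_le_imp_le) (rule norm_ge_zero)
qed

lemma one_plus_mult_nonzero:
  fixes w e :: complex
  assumes "norm w < 1" "norm e \<le> 1"
  shows "1 + e * w \<noteq> 0"
proof
  assume "1 + e * w = 0"
  hence "norm (e * w) = 1" by (metis add_eq_0_iff norm_minus_cancel norm_one)
  moreover have "norm e * norm w \<le> 1 * norm w" using assms by (intro mult_right_mono) auto
  ultimately show False using assms by (simp add: norm_mult)
qed

section \<open>The weighted supremum\<close>

lemma hyperbolic_norm_upper:
  "z \<in> unit_disc \<Longrightarrow> ereal ((1 - (norm z)\<^sup>2) * norm (P z)) \<le> hyperbolic_norm P"
  unfolding hyperbolic_norm_def by (rule SUP_upper)

lemma hyperbolic_norm_nonneg: "0 \<le> hyperbolic_norm P"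
  using order_trans[OF _ hyperbolic_norm_upper[of 0 P], of 0] by simp

lemma hyperbolic_norm_le_add:
  assumes "\<And>z. z \<in> unit_disc \<Longrightarrow> (1 - (norm z)\<^sup>2) * norm (P z - Q z) \<le> C"
  shows "hyperbolic_norm P \<le> hyperbolic_norm Q + ereal C"
  unfolding hyperbolic_norm_def[of P]
proof (rule SUP_least)
  fix z :: complex assume z: "z \<in> unit_disc"
  have "1 - (norm z)\<^sup>2 \<ge> 0" using z by (simp add: power_le_one)
  hence "(1 - (norm z)\<^sup>2) * norm (P z)
      \<le> (1 - (norm z)\<^sup>2) * (norm (Q z) + norm (P z - Q z))"
    by (intro mult_left_mono norm_triangle_sub)
  also have "\<dots> \<le> (1 - (norm z)\<^sup>2) * norm (Q z) + C"
    using assms[OF z] by (simp add: distrib_left)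
  finally have "ereal ((1 - (norm z)\<^sup>2) * norm (P z))
      \<le> ereal ((1 - (norm z)\<^sup>2) * norm (Q z)) + ereal C" by simp
  also have "\<dots> \<le> hyperbolic_norm Q + ereal C"
    by (intro add_right_mono hyperbolic_norm_upper z)
  finally show "ereal ((1 - (norm z)\<^sup>2) * norm (P z)) \<le> hyperbolic_norm Q + ereal C" .
qed

text \<open>
  Each norm is at most the other plus \<open>C\<close>.  The bound on the difference is claimed only when both are
  finite, because the extended real \<open>\<infinity> - \<infinity>\<close> is \<open>\<infinity>\<close>.
\<close>

lemma hyperbolic_norm_diff_le:
  assumes "\<And>z. z \<in> unit_disc \<Longrightarrow> (1 - (norm z)\<^sup>2) * norm (P z - Q z) \<le> C"
  shows "hyperbolic_norm P = \<infinity> \<and> hyperbolic_norm Q = \<infinity> \<or>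
         \<bar>hyperbolic_norm P\<bar> \<noteq> \<infinity> \<and> \<bar>hyperbolic_norm Q\<bar> \<noteq> \<infinity> \<and>
         \<bar>hyperbolic_norm P - hyperbolic_norm Q\<bar> \<le> ereal C"
proof -
  have PQ: "hyperbolic_norm P \<le> hyperbolic_norm Q + ereal C"
    using assms by (rule hyperbolic_norm_le_add)
  have QP: "hyperbolic_norm Q \<le> hyperbolic_norm P + ereal C"
    using assms by (intro hyperbolic_norm_le_add) (simp add: norm_minus_commute)
  show ?thesis
    using PQ QP hyperbolic_norm_nonneg[of P] hyperbolic_norm_nonneg[of Q]
    by (cases "hyperbolic_norm P"; cases "hyperbolic_norm Q") auto
qed

section \<open>Wirtinger derivatives and the Jacobian\<close>

lemma wirtinger_z_of_has_derivative:
  "(f has_derivative D) (at z) \<Longrightarrow> wirtinger_z f z = (D 1 - \<i> * D \<i>) / 2"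
  by (simp add: wirtinger_z_def frechet_derivative_at[symmetric])

lemma wirtinger_zbar_of_has_derivative:
  "(f has_derivative D) (at z) \<Longrightarrow> wirtinger_zbar f z = (D 1 + \<i> * D \<i>) / 2"
  by (simp add: wirtinger_zbar_def frechet_derivative_at[symmetric])

text \<open>
  The differential of a real-valued \<open>u\<close> is \<open>v \<mapsto> 2 Re (u\<^sub>z v)\<close>, so the Wirtinger derivative can be
  read off from it.
\<close>

lemma wirtinger_z_of_real:
  assumes "(u has_derivative (\<lambda>v. 2 * Re (c * v))) (at z)"
  shows "wirtinger_z (\<lambda>z. complex_of_real (u z)) z = c"
proof -
  have "((\<lambda>z. complex_of_real (u z)) has_derivative (\<lambda>v. of_real (2 * Re (c * v)))) (at z)"
    using assms by (rule has_derivative_of_real)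
  thus ?thesis
    by (simp add: wirtinger_z_of_has_derivative complex_eq_iff)
qed

lemma has_derivative_norm_square_holomorphic:
  assumes "(F has_field_derivative F') (at z)"
  shows "((\<lambda>w. (norm (F w))\<^sup>2) has_derivative (\<lambda>v. 2 * Re (F' * cnj (F z) * v))) (at z)"
proof -
  have "(F has_derivative (\<lambda>v. F' * v)) (at z)"
    using assms by (simp add: has_field_derivative_def)
  hence "((\<lambda>w. F w \<bullet> F w) has_derivative (\<lambda>v. F z \<bullet> (F' * v) + (F' * v) \<bullet> F z)) (at z)"
    by (intro has_derivative_inner)
  moreover have "(\<lambda>v. F z \<bullet> (F' * v) + (F' * v) \<bullet> F z) = (\<lambda>v. 2 * Re (F' * cnj (F z) * v))"
    by (rule ext) (simp add: inner_complex_def algebra_simps)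
  ultimately show ?thesis by (simp add: power2_norm_eq_inner)
qed

lemma jacobian_mult_cnj:
  assumes h: "h holomorphic_on unit_disc" and g: "g holomorphic_on unit_disc"
    and f: "\<And>z. z \<in> unit_disc \<Longrightarrow> f z = h z * cnj (g z)" and z: "z \<in> unit_disc"
  shows "jacobian f z = (norm (deriv h z * g z))\<^sup>2 - (norm (h z * deriv g z))\<^sup>2"
proof -
  have dh: "(h has_derivative (\<lambda>v. deriv h z * v)) (at z)"
    and dg: "(g has_derivative (\<lambda>v. deriv g z * v)) (at z)"
    using holomorphic_derivI[OF h _ z] holomorphic_derivI[OF g _ z]
    by (auto simp: has_field_derivative_def)
  have "((\<lambda>z. h z * cnj (g z)) has_derivative
      (\<lambda>v. h z * cnj (deriv g z * v) + deriv h z * v * cnj (g z))) (at z)"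
    by (intro has_derivative_mult dh has_derivative_cnj dg)
  hence D: "(f has_derivative
      (\<lambda>v. h z * cnj (deriv g z * v) + deriv h z * v * cnj (g z))) (at z)"
    by (rule has_derivative_transform_within_open[where s = unit_disc]) (use z f in auto)
  have "wirtinger_z f z = deriv h z * cnj (g z)"
    unfolding wirtinger_z_of_has_derivative[OF D] by (simp add: algebra_simps)
  moreover have "wirtinger_zbar f z = h z * cnj (deriv g z)"
    unfolding wirtinger_zbar_of_has_derivative[OF D] by (simp add: algebra_simps)
  ultimately show ?thesis
    by (simp add: jacobian_def norm_mult)
qed

section \<open>The two pre-Schwarzian derivatives\<close>

text \<open>
  With \<open>F = h' g\<close> and \<open>G = h g' = \<omega> F\<close>, differentiating the logarithm of
  \<open>J = \<bar>F\<bar>\<^sup>2 - \<bar>G\<bar>\<^sup>2\<close> gives \<open>(F' cnj F - G' cnj G) / J\<close>, in which \<open>G' = \<omega>' F + \<omega> F'\<close>.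
\<close>

lemma pre_schwarzian_log_harmonic_eq:
  assumes h: "h holomorphic_on unit_disc" and g: "g holomorphic_on unit_disc"
    and w: "\<omega> holomorphic_on unit_disc"
    and f: "\<And>z. z \<in> unit_disc \<Longrightarrow> f z = h z * cnj (g z)"
    and dil: "\<And>z. z \<in> unit_disc \<Longrightarrow> h z * deriv g z = \<omega> z * (deriv h z * g z)"
    and w1: "norm (\<omega> z) < 1" and J: "jacobian f z > 0" and z: "z \<in> unit_disc"
  shows "pre_schwarzian_log_harmonic f z =
     deriv (deriv h) z / deriv h z + deriv g z / g z
       - cnj (\<omega> z) * deriv \<omega> z / (1 - of_real ((norm (\<omega> z))\<^sup>2))"
proof -
  define F where "F = (\<lambda>z. deriv h z * g z)"
  define G where "G = (\<lambda>z. \<omega> z * F z)"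
  define F' where "F' = deriv (deriv h) z * g z + deriv g z * deriv h z"
  define G' where "G' = deriv \<omega> z * F z + F' * \<omega> z"
  have h': "deriv h holomorphic_on unit_disc" by (rule holomorphic_deriv[OF h]) simp
  have dF: "(F has_field_derivative F') (at z)"
    unfolding F_def F'_def
    by (intro DERIV_mult holomorphic_derivI[OF h' _ z] holomorphic_derivI[OF g _ z]) auto
  have dG: "(G has_field_derivative G') (at z)"
    unfolding G_def G'_def
    by (intro DERIV_mult holomorphic_derivI[OF w _ z] dF) auto
  have Jeq: "jacobian f x = (norm (F x))\<^sup>2 - (norm (G x))\<^sup>2" if "x \<in> unit_disc" for x
    using jacobian_mult_cnj[OF h g f that] dil[OF that] by (simp add: F_def G_def)
  have Fz: "F z \<noteq> 0" using J Jeq[OF z] by (auto simp: G_def)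
  hence nz: "deriv h z \<noteq> 0" "g z \<noteq> 0" by (auto simp: F_def)
  define c where "c = F' * cnj (F z) - G' * cnj (G z)"
  have "((\<lambda>x. (norm (F x))\<^sup>2 - (norm (G x))\<^sup>2) has_derivative
      (\<lambda>v. 2 * Re (F' * cnj (F z) * v) - 2 * Re (G' * cnj (G z) * v))) (at z)"
    by (intro has_derivative_diff has_derivative_norm_square_holomorphic dF dG)
  hence "(jacobian f has_derivative
      (\<lambda>v. 2 * Re (F' * cnj (F z) * v) - 2 * Re (G' * cnj (G z) * v))) (at z)"
    by (rule has_derivative_transform_within_open[where s = unit_disc]) (use z Jeq in auto)
  hence "((\<lambda>x. ln (jacobian f x)) has_derivative
      (\<lambda>v. (2 * Re (F' * cnj (F z) * v) - 2 * Re (G' * cnj (G z) * v)) * inverse (jacobian f z)))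
      (at z)"
    using J by (intro has_derivative_ln) auto
  also have "(\<lambda>v. (2 * Re (F' * cnj (F z) * v) - 2 * Re (G' * cnj (G z) * v))
        * inverse (jacobian f z)) = (\<lambda>v. 2 * Re (c / of_real (jacobian f z) * v))"
    by (rule ext) (use J in \<open>simp add: c_def field_simps\<close>)
  finally have "pre_schwarzian_log_harmonic f z = c / of_real (jacobian f z)"
    unfolding pre_schwarzian_log_harmonic_def by (rule wirtinger_z_of_real)
  also have "of_real (jacobian f z) = F z * cnj (F z) * (1 - of_real ((norm (\<omega> z))\<^sup>2))"
    unfolding Jeq[OF z] G_def
    by (simp only: norm_mult power_mult_distrib of_real_diff of_real_mult complex_norm_square)
       (simp add: algebra_simps)
  also have "c / \<dots> = F' / F z - cnj (\<omega> z) * deriv \<omega> z / (1 - of_real ((norm (\<omega> z))\<^sup>2))"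
  proof -
    have "(norm (\<omega> z))\<^sup>2 \<noteq> 1" using w1 abs_square_less_1[of "norm (\<omega> z)"] by auto
    hence "1 - complex_of_real ((norm (\<omega> z))\<^sup>2) \<noteq> 0"
      by (metis eq_iff_diff_eq_0 of_real_eq_1_iff)
    moreover have "c = F' * cnj (F z) * (1 - of_real ((norm (\<omega> z))\<^sup>2))
        - cnj (\<omega> z) * deriv \<omega> z * (F z * cnj (F z))"
      unfolding c_def G'_def G_def complex_norm_square by (simp add: algebra_simps)
    ultimately show ?thesis using Fz by (simp add: divide_simps) (simp add: algebra_simps)
  qed
  also have "F' / F z = deriv (deriv h) z / deriv h z + deriv g z / g z"
    using nz by (simp add: F'_def F_def field_simps)
  finally show ?thesis .
qed

lemma log_branch_has_field_derivative:
  assumes g: "g holomorphic_on unit_disc" and nz: "\<And>z. z \<in> unit_disc \<Longrightarrow> g z \<noteq> 0"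
    and z: "z \<in> unit_disc"
  shows "(log_branch g has_field_derivative deriv g z / g z) (at z)"
proof -
  have L: "is_log_branch g (log_branch g)" using is_log_branch_log_branch[OF g nz] .
  hence d: "(log_branch g has_field_derivative deriv (log_branch g) z) (at z)"
    using z by (auto simp: is_log_branch_def intro: holomorphic_derivI)
  have "((\<lambda>x. exp (log_branch g x)) has_field_derivative
      exp (log_branch g z) * deriv (log_branch g) z) (at z)"
    using d by (auto intro!: derivative_eq_intros)
  hence "(g has_field_derivative exp (log_branch g z) * deriv (log_branch g) z) (at z)"
    by (rule has_field_derivative_transform_within_open[where S = unit_disc])
       (use z L in \<open>auto simp: is_log_branch_def\<close>)
  hence "deriv g z = g z * deriv (log_branch g) z"
    using L z by (simp add: DERIV_imp_deriv is_log_branch_def)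
  thus ?thesis using d nz[OF z] by simp
qed

text \<open>
  The relation \<open>h g' = \<omega> h' g\<close> turns \<open>(h g\<^sup>\<epsilon>)'\<close> into the product \<open>h' g\<^sup>\<epsilon> (1 + \<epsilon> \<omega>)\<close>, whose
  logarithmic derivative is the sum of those of its factors.
\<close>

lemma pre_schwarzian_mult_branch_power:
  assumes h: "h holomorphic_on unit_disc" and g: "g holomorphic_on unit_disc"
    and w: "\<omega> holomorphic_on unit_disc"
    and gnz: "\<And>z. z \<in> unit_disc \<Longrightarrow> g z \<noteq> 0"
    and dil: "\<And>z. z \<in> unit_disc \<Longrightarrow> h z * deriv g z = \<omega> z * (deriv h z * g z)"
    and z: "z \<in> unit_disc" and h'nz: "deriv h z \<noteq> 0" and nz: "1 + \<epsilon> * \<omega> z \<noteq> 0"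
  shows "pre_schwarzian (\<lambda>z. h z * branch_power g \<epsilon> z) z =
     deriv (deriv h) z / deriv h z + \<epsilon> * (deriv g z / g z)
       + \<epsilon> * deriv \<omega> z / (1 + \<epsilon> * \<omega> z)"
proof -
  define E where "E = branch_power g \<epsilon>"
  \<comment> \<open>\<open>E = g\<^sup>\<epsilon>\<close>; \<open>D\<close> below is the derivative of \<open>h E\<close>.\<close>
  have dE: "(E has_field_derivative \<epsilon> * (deriv g x / g x) * E x) (at x)" if "x \<in> unit_disc" for x
    unfolding E_def branch_power_def using log_branch_has_field_derivative[OF g gnz that]
    by (auto intro!: derivative_eq_intros)
  have Enz: "E z \<noteq> 0" by (simp add: E_def branch_power_def)
  define D where "D = (\<lambda>x. deriv h x * (1 + \<epsilon> * \<omega> x) * E x)"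
  have D: "deriv (\<lambda>z. h z * E z) x = D x" if x: "x \<in> unit_disc" for x
  proof -
    have "((\<lambda>z. h z * E z) has_field_derivative
        deriv h x * E x + \<epsilon> * (deriv g x / g x) * E x * h x) (at x)"
      by (intro DERIV_mult holomorphic_derivI[OF h _ x] dE x) auto
    moreover have "deriv h x * E x + \<epsilon> * (deriv g x / g x) * E x * h x
        = deriv h x * E x + \<epsilon> * E x * (h x * deriv g x) / g x" by simp
    moreover have "\<dots> = D x"
      using gnz[OF x] unfolding dil[OF x] D_def by (simp add: algebra_simps)
    ultimately show ?thesis by (metis DERIV_imp_deriv)
  qed
  have h': "deriv h holomorphic_on unit_disc" by (rule holomorphic_deriv[OF h]) simp
  define D' where "D' = deriv (deriv h) z * (1 + \<epsilon> * \<omega> z) * E z + deriv h z * (\<epsilon> * deriv \<omega> z) * E z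
      + deriv h z * (1 + \<epsilon> * \<omega> z) * (\<epsilon> * (deriv g z / g z) * E z)"
  have "(D has_field_derivative D') (at z)"
    unfolding D_def D'_def
    using holomorphic_derivI[OF h' _ z] holomorphic_derivI[OF w _ z] dE[OF z]
    by (auto intro!: derivative_eq_intros simp: algebra_simps)
  hence "(deriv (\<lambda>z. h z * E z) has_field_derivative D') (at z)"
    by (rule has_field_derivative_transform_within_open[where S = unit_disc]) (use z D in auto)
  hence "deriv (deriv (\<lambda>z. h z * E z)) z = D'" by (rule DERIV_imp_deriv)
  hence "pre_schwarzian (\<lambda>z. h z * E z) z = D' / D z"
    by (simp add: pre_schwarzian_def D[OF z])
  also have "\<dots> = deriv (deriv h) z / deriv h z + \<epsilon> * (deriv g z / g z)
       + \<epsilon> * deriv \<omega> z / (1 + \<epsilon> * \<omega> z)"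
    using Enz h'nz nz gnz[OF z] by (simp add: D'_def D_def add_divide_distrib)
  finally show ?thesis unfolding E_def .
qed

text \<open>
  The estimate from which everything follows, at a single point and with \<open>p\<close>, \<open>x\<close>, \<open>y\<close> the
  values of \<open>h'' / h'\<close>, \<open>g' / g\<close> and \<open>\<omega>'\<close>: the two terms containing \<open>\<omega>'\<close> combine into \<open>\<omega>' / (1 - \<bar>\<omega>\<bar>\<^sup>2)\<close> times a factor of
  modulus at most \<open>1\<close>.
\<close>

lemma norm_pre_schwarzian_difference_le:
  fixes w e x y p :: complex
  assumes w: "norm w < 1" and e: "norm e \<le> 1"
  shows "norm ((p + x - cnj w * y / (1 - of_real ((norm w)\<^sup>2))) - (p + e * x + e * y / (1 + e * w)))
    \<le> norm (1 - e) * norm x + norm y / (1 - (norm w)\<^sup>2)"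
proof -
  define s where "s = 1 - (norm w)\<^sup>2"
  have s: "s > 0" using w by (simp add: s_def abs_square_less_1)
  have sc: "1 - complex_of_real ((norm w)\<^sup>2) = of_real s" by (simp add: s_def)
  have nz: "1 + e * w \<noteq> 0" using w e by (rule one_plus_mult_nonzero)
  have key: "cnj w * (1 + e * w) + e * of_real s = cnj w + e"
    by (simp only: s_def of_real_diff of_real_1 complex_norm_square) (simp add: algebra_simps)
  have "cnj w * y / of_real s + e * y / (1 + e * w)
      = (cnj w * (1 + e * w) + e * of_real s) / (1 + e * w) * (y / of_real s)"
    using s nz by (simp add: field_simps)
  hence "cnj w * y / of_real s + e * y / (1 + e * w) = (cnj w + e) / (1 + e * w) * (y / of_real s)"
    unfolding key .
  hence "(p + x - cnj w * y / of_real s) - (p + e * x + e * y / (1 + e * w))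
      = (1 - e) * x - (cnj w + e) / (1 + e * w) * (y / of_real s)"
    by (simp add: algebra_simps)
  also have "norm \<dots> \<le> norm ((1 - e) * x) + norm ((cnj w + e) / (1 + e * w) * (y / of_real s))"
    by (rule norm_triangle_ineq4)
  also have "norm ((cnj w + e) / (1 + e * w) * (y / of_real s)) \<le> 1 * norm (y / of_real s)"
    unfolding norm_mult
    using norm_cnj_add_le[of w e] w e nz by (intro mult_right_mono) (auto simp: norm_divide)
  also have "1 * norm (y / of_real s) = norm y / s" using s by (simp add: norm_divide)
  finally show ?thesis unfolding sc by (simp add: norm_mult s_def)
qed

section \<open>Comparison of the norms\<close>

theorem theorem2p2:
  fixes f h g \<omega> :: "complex \<Rightarrow> complex"
  assumes "nonvanishing_log_harmonic f h g \<omega>"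
    and "sense_preserving_locally_univalent f"
    and "\<And>z. z \<in> unit_disc \<Longrightarrow> \<omega> z = deriv g z * h z / (deriv h z * g z)"
    and "bloch_function (log_branch g)"
  shows
    "(\<forall>\<epsilon>\<in>cball 0 1.
        (hyperbolic_norm (pre_schwarzian_log_harmonic f) = \<infinity> \<and>
         hyperbolic_norm (pre_schwarzian (\<lambda>z. h z * branch_power g \<epsilon> z)) = \<infinity>) \<or>
        (\<bar>hyperbolic_norm (pre_schwarzian_log_harmonic f)\<bar> \<noteq> \<infinity> \<and>
         \<bar>hyperbolic_norm (pre_schwarzian (\<lambda>z. h z * branch_power g \<epsilon> z))\<bar> \<noteq> \<infinity>)) \<and>
     (\<bar>hyperbolic_norm (pre_schwarzian_log_harmonic f)\<bar> \<noteq> \<infinity> \<longrightarrow>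
        (\<forall>\<epsilon>\<in>cball 0 1.
           \<bar>hyperbolic_norm (pre_schwarzian_log_harmonic f)
              - hyperbolic_norm (pre_schwarzian (\<lambda>z. h z * branch_power g \<epsilon> z))\<bar>
             \<le> 1 + ereal (norm (1 - \<epsilon>)) * bloch_seminorm (log_branch g) \<and>
           1 + ereal (norm (1 - \<epsilon>)) * bloch_seminorm (log_branch g)
             \<le> 1 + 2 * bloch_seminorm (log_branch g)) \<and>
        \<bar>hyperbolic_norm (pre_schwarzian_log_harmonic f) - hyperbolic_norm (pre_schwarzian h)\<bar>
          \<le> 1 + bloch_seminorm (log_branch g))"
proof -
  let ?N = "\<lambda>e. hyperbolic_norm (pre_schwarzian (\<lambda>z. h z * branch_power g e z))"
  let ?Nf = "hyperbolic_norm (pre_schwarzian_log_harmonic f)"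
  have h: "h holomorphic_on unit_disc" and g: "g holomorphic_on unit_disc"
    and w: "\<omega> holomorphic_on unit_disc" and wsub: "\<omega> ` unit_disc \<subseteq> unit_disc"
    and gnz: "\<And>z. z \<in> unit_disc \<Longrightarrow> g z \<noteq> 0"
    and f: "\<And>z. z \<in> unit_disc \<Longrightarrow> f z = h z * cnj (g z)"
    using assms(1) by (auto simp: nonvanishing_log_harmonic_def)
  have J: "jacobian f z > 0" if "z \<in> unit_disc" for z
    using assms(2) that by (simp add: sense_preserving_locally_univalent_def)
  \<comment> \<open>Where \<open>h'\<close> vanishes, the Jacobian is \<open>- \<bar>h g'\<bar>\<^sup>2\<close> and cannot be positive.\<close>
  have h'nz: "deriv h z \<noteq> 0" if z: "z \<in> unit_disc" for z
    using J[OF z] jacobian_mult_cnj[OF h g f z] by auto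
  have dil: "h z * deriv g z = \<omega> z * (deriv h z * g z)" if z: "z \<in> unit_disc" for z
    using assms(3)[OF z] h'nz[OF z] gnz[OF z] by simp
  obtain b where b: "bloch_seminorm (log_branch g) = ereal b" and b0: "b \<ge> 0"
    using assms(4) hyperbolic_norm_nonneg[of "deriv (log_branch g)"]
    by (cases "bloch_seminorm (log_branch g)") (auto simp: bloch_function_def bloch_seminorm_def)
  have bz: "(1 - (norm z)\<^sup>2) * norm (deriv g z / g z) \<le> b" if z: "z \<in> unit_disc" for z
    using hyperbolic_norm_upper[OF z, of "deriv (log_branch g)"] b
      DERIV_imp_deriv[OF log_branch_has_field_derivative[OF g gnz z]]
    by (simp add: bloch_seminorm_def)
  have main: "(1 - (norm z)\<^sup>2) * norm (pre_schwarzian_log_harmonic f z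
      - pre_schwarzian (\<lambda>z. h z * branch_power g e z) z) \<le> 1 + norm (1 - e) * b"
    if e: "norm e \<le> 1" and z: "z \<in> unit_disc" for e z
  proof -
    have w1: "norm (\<omega> z) < 1" using image_subset_iff[THEN iffD1, OF wsub] z by auto
    hence s: "1 - (norm (\<omega> z))\<^sup>2 > 0" by (simp add: abs_square_less_1)
    have r: "1 - (norm z)\<^sup>2 \<ge> 0" using z by (simp add: power_le_one)
    have "norm (pre_schwarzian_log_harmonic f z - pre_schwarzian (\<lambda>z. h z * branch_power g e z) z)
        \<le> norm (1 - e) * norm (deriv g z / g z) + norm (deriv \<omega> z) / (1 - (norm (\<omega> z))\<^sup>2)"
    proof -
      have "pre_schwarzian_log_harmonic f z = deriv (deriv h) z / deriv h z + deriv g z / g z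
          - cnj (\<omega> z) * deriv \<omega> z / (1 - of_real ((norm (\<omega> z))\<^sup>2))"
        using h g w f dil w1 J[OF z] z by (rule pre_schwarzian_log_harmonic_eq)
      moreover have "pre_schwarzian (\<lambda>z. h z * branch_power g e z) z
          = deriv (deriv h) z / deriv h z + e * (deriv g z / g z) + e * deriv \<omega> z / (1 + e * \<omega> z)"
        using h g w gnz dil z h'nz[OF z] one_plus_mult_nonzero[OF w1 e]
        by (rule pre_schwarzian_mult_branch_power)
      ultimately show ?thesis
        using norm_pre_schwarzian_difference_le[OF w1 e] by (simp only:)
    qed
    hence "(1 - (norm z)\<^sup>2) * norm (pre_schwarzian_log_harmonic f z
        - pre_schwarzian (\<lambda>z. h z * branch_power g e z) z)
      \<le> (1 - (norm z)\<^sup>2) * (norm (1 - e) * norm (deriv g z / g z)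
          + norm (deriv \<omega> z) / (1 - (norm (\<omega> z))\<^sup>2))"
      using r by (rule mult_left_mono)
    also have "\<dots> = norm (1 - e) * ((1 - (norm z)\<^sup>2) * norm (deriv g z / g z))
        + (1 - (norm z)\<^sup>2) * norm (deriv \<omega> z) / (1 - (norm (\<omega> z))\<^sup>2)"
      by (simp add: distrib_left mult.left_commute)
    also have "\<dots> \<le> norm (1 - e) * b + 1"
      using Schwarz_Pick_deriv[OF w wsub z] bz[OF z] s
      by (intro add_mono mult_left_mono) (auto simp: divide_le_eq_1)
    finally show ?thesis by simp
  qed
  have cmp: "?Nf = \<infinity> \<and> ?N e = \<infinity> \<or>
      \<bar>?Nf\<bar> \<noteq> \<infinity> \<and> \<bar>?N e\<bar> \<noteq> \<infinity> \<and> \<bar>?Nf - ?N e\<bar> \<le> ereal (1 + norm (1 - e) * b)"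
    if "norm e \<le> 1" for e
    using main[OF that] by (rule hyperbolic_norm_diff_le)
  have two: "norm (1 - e) * b \<le> 2 * b" if "norm e \<le> 1" for e :: complex
    using norm_triangle_ineq4[of 1 e] that b0 by (intro mult_right_mono) auto
  have bound: "1 + ereal (norm (1 - e)) * bloch_seminorm (log_branch g) = ereal (1 + norm (1 - e) * b)"
    for e :: complex
    by (simp add: b one_ereal_def)
  have bound2: "1 + 2 * bloch_seminorm (log_branch g) = ereal (1 + 2 * b)"
    by (simp add: b one_ereal_def)
  have N0: "?N 0 = hyperbolic_norm (pre_schwarzian h)"
    by (simp add: branch_power_def)
  show ?thesis
  proof (intro conjI impI ballI)
    fix e :: complex assume "e \<in> cball 0 1"
    hence e: "norm e \<le> 1" by simp
    show "?Nf = \<infinity> \<and> ?N e = \<infinity> \<or> \<bar>?Nf\<bar> \<noteq> \<infinity> \<and> \<bar>?N e\<bar> \<noteq> \<infinity>"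
      using cmp[OF e] by argo
    show "1 + ereal (norm (1 - e)) * bloch_seminorm (log_branch g)
        \<le> 1 + 2 * bloch_seminorm (log_branch g)"
      unfolding bound bound2 using two[OF e] by simp
    show "\<bar>?Nf - ?N e\<bar> \<le> 1 + ereal (norm (1 - e)) * bloch_seminorm (log_branch g)"
      if "\<bar>?Nf\<bar> \<noteq> \<infinity>"
      unfolding bound using cmp[OF e] that by (elim disjE conjE) simp_all
  next
    assume "\<bar>?Nf\<bar> \<noteq> \<infinity>"
    hence "\<bar>?Nf - ?N 0\<bar> \<le> 1 + ereal (norm (1 - 0 :: complex)) * bloch_seminorm (log_branch g)"
      unfolding bound using cmp[of 0, unfolded norm_zero, OF zero_le_one] by (elim disjE conjE) simp_all
    thus "\<bar>?Nf - hyperbolic_norm (pre_schwarzian h)\<bar> \<le> 1 + bloch_seminorm (log_branch g)"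
      unfolding N0 by (simp add: b)
  qed
qed

end
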